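(* Let $X$ be a finite set with $|X|\geq 3$ and let $\mathcal P$ be a uniform partition of $X$. Then the group $S(X,\mathcal P)$ is generated by two elements.
   Context: A partition $\mathcal P=\{P_1,\ldots,P_m\}$ of $X$ is a collection of pairwise disjoint non-empty subsets with union $X$; $\sim_{\mathcal P}$ denotes the corresponding equivalence relation. The partition is uniform if $|P_i|=|P_j|$ for all $i,j$. Transformations act on the right: $xf$ is the image of $x$ under $f$. $S(X,\mathcal P)$ denotes the group of all permutations $f$ of $X$ that preserve $\mathcal P$, i.e. such that for all $x,y\in X$, $x\sim_{\mathcal P}y$ implies $xf\sim_{\mathcal P}yf$. *)

theory Defs
  imports
    "HOL-Algebra.Bij"
    "HOL-Algebra.Generated_Groups"
    "HOL-Library.Disjoint_Sets"
begin

definition same_block :: "'a set set \<Rightarrow> 'a \<Rightarrow> 'a \<Rightarrow> bool" where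
  "same_block P x y \<longleftrightarrow> (\<exists>B\<in>P. x \<in> B \<and> y \<in> B)"

text \<open>Blocks are compared by \<^const>\<open>card\<close>, so this is meant for partitions into finite
  blocks only (all infinite sets have \<^const>\<open>card\<close> 0).\<close>

definition uniform_partition_on :: "'a set \<Rightarrow> 'a set set \<Rightarrow> bool" where
  "uniform_partition_on X P \<longleftrightarrow> partition_on X P \<and> (\<forall>A\<in>P. \<forall>B\<in>P. card A = card B)"

text \<open>Permutations of \<open>X\<close> are, as in \<^const>\<open>BijGroup\<close>, the extensional bijections of \<open>X\<close>.
  The product \<open>f \<otimes> g\<close> applies \<open>f\<close> first, since transformations act on the right;
  \<^const>\<open>BijGroup\<close> composes in the opposite order.\<close>

definition partition_perm_group :: "'a set \<Rightarrow> 'a set set \<Rightarrow> ('a \<Rightarrow> 'a) monoid" where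
  "partition_perm_group X P =
    \<lparr>carrier = {f \<in> Bij X. \<forall>x\<in>X. \<forall>y\<in>X. same_block P x y \<longrightarrow> same_block P (f x) (f y)},
     mult = \<lambda>f g. compose X g f,
     one = \<lambda>x\<in>X. x\<rparr>"

text \<open>The inverse of a block-preserving permutation is block-preserving because \<open>X\<close> is finite.\<close>

lemma group_partition_perm_group:
  assumes fin: "finite X"
  shows "group (partition_perm_group X P)"
proof (rule groupI)
  let ?G = "partition_perm_group X P"
  fix f assume f: "f \<in> carrier ?G"
  then have fB: "f \<in> Bij X" and bij: "bij_betw f X X"
    and pres: "\<And>x y. x \<in> X \<Longrightarrow> y \<in> X \<Longrightarrow> same_block P x y \<Longrightarrow> same_block P (f x) (f y)"
    by (auto simp: partition_perm_group_def Bij_def)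
  let ?R = "{(x, y) \<in> X \<times> X. same_block P x y}"
  let ?g = "\<lambda>x\<in>X. inv_into X f x"
  have finR: "finite ?R"
    by (rule finite_subset[of _ "X \<times> X"]) (auto simp: fin)
  have "map_prod f f ` ?R \<subseteq> ?R"
    using pres bij by (auto simp: bij_betw_def)
  moreover have "inj_on (map_prod f f) ?R"
    using bij by (auto simp: bij_betw_def inj_on_def)
  ultimately have surj: "map_prod f f ` ?R = ?R"
    by (rule endo_inj_surj[OF finR])
  have "same_block P (?g x) (?g y)" if "x \<in> X" "y \<in> X" "same_block P x y" for x y
  proof -
    have "(x, y) \<in> map_prod f f ` ?R" unfolding surj using that by simp
    then obtain u v where "u \<in> X" "v \<in> X" "same_block P u v" "x = f u" "y = f v" by auto
    then show ?thesis using that bij by (simp add: bij_betw_def inv_into_f_f)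
  qed
  then have "?g \<in> carrier ?G"
    using restrict_inv_into_Bij[OF fB] by (simp add: partition_perm_group_def)
  moreover have "?g \<otimes>\<^bsub>?G\<^esub> f = \<one>\<^bsub>?G\<^esub>"
    using bij by (auto simp: partition_perm_group_def compose_def bij_betw_def f_inv_into_f
        intro!: restrict_ext)
  ultimately show "\<exists>g\<in>carrier ?G. g \<otimes>\<^bsub>?G\<^esub> f = \<one>\<^bsub>?G\<^esub>" by blast
next
  let ?G = "partition_perm_group X P"
  fix f g assume "f \<in> carrier ?G" "g \<in> carrier ?G"
  then show "f \<otimes>\<^bsub>?G\<^esub> g \<in> carrier ?G"
    using Bij_imp_funcset[of f X]
    by (auto simp: partition_perm_group_def compose_Bij compose_eq Pi_iff)
next
  let ?G = "partition_perm_group X P"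
  fix f assume "f \<in> carrier ?G"
  then show "\<one>\<^bsub>?G\<^esub> \<otimes>\<^bsub>?G\<^esub> f = f"
    using compose_Id[OF Bij_imp_funcset Bij_imp_extensional, of f X]
    by (simp add: partition_perm_group_def)
qed (auto simp: partition_perm_group_def id_Bij Bij_imp_funcset compose_assoc[symmetric])

end

theory Submission
  imports Defs "HOL-Combinatorics.Permutations"
begin

text \<open>
  Arrange \<open>X\<close> as a grid with \<open>m\<close> rows of length \<open>n\<close>, the rows being the blocks. Then
  \<open>S(X, \<P>)\<close> is the wreath product of the symmetric group on the \<open>n\<close> entries of a row with the
  symmetric group on the \<open>m\<close> rows.

  Let \<open>H\<close> be a group of permutations of a finite set. Since
  \<open>(x y)(y z)(x y) = (x z)\<close>, the relation ``the transposition \<open>(x y)\<close> lies in \<open>H\<close>'' is an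
  equivalence, and conjugation shows that it is preserved by \<open>H\<close>. So a single transposition can
  be spread by the other elements of \<open>H\<close>. This is used twice: for the permutations of the rows
  that \<open>H\<close> induces, and for the entries within a row. It follows
  (\<open>row_perms_subset_if_rotations\<close>) that \<open>H\<close> contains the whole wreath product as soon as
  \<^item> \<open>H\<close> induces on the rows a cycle of length \<open>m\<close> or \<open>m - 1\<close> and the transposition \<open>(0 m-1)\<close>;
  \<^item> for one row \<open>b\<close>, some element of \<open>H\<close> maps \<open>b\<close> to itself by a cycle of length \<open>n\<close> or
    \<open>n - 1\<close>, and the transposition \<open>t\<close> of the first and last entry of row \<open>b\<close>, fixing everything
    else, lies in \<open>H\<close>.

  It remains to choose two generators. The difficulty is to obtain \<open>t\<close> on a single row, which is
  done by taking powers, so the parity of \<open>m\<close> matters.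

  If \<open>m\<close> is even, let \<open>f\<close> rotate the rows \<open>0, \<dots>, m-2\<close> and apply \<open>t\<close> to the last row, and let \<open>g\<close>
  exchange the first and last row with an \<open>n\<close>-cycle as twist. As \<open>m - 1\<close> is odd, \<open>f\<^sup>m\<^sup>-\<^sup>1\<close> is \<open>t\<close> on
  the last row alone, while \<open>g\<^sup>2\<close> acts on that row as the \<open>n\<close>-cycle.

  If \<open>m\<close> is odd, let \<open>f\<close> rotate all rows with twist \<open>t\<close>, let \<open>k\<close> be the odd one of \<open>n\<close> and
  \<open>n - 1\<close>, and let \<open>g\<close> exchange the last two rows with twist \<open>t\<close> and act on row \<open>0\<close> as a
  \<open>k\<close>-cycle. Then \<open>f\<^sup>m\<close> is \<open>t\<close> on every row, and \<open>g\<^sup>2\<^sup>k\<close> is \<open>t\<close> on the last two rows only, because the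
  \<open>k\<close>-cycle dies and \<open>k\<close> is odd. Conjugating by \<open>f\<close> gives \<open>t\<close> on any two adjacent rows, and as
  \<open>m\<close> is odd, multiplying \<open>f\<^sup>m\<close> by \<open>(m - 1) / 2\<close> of these leaves \<open>t\<close> on row \<open>0\<close> alone. The row
  transposition \<open>(0 m-1)\<close> is the one induced by \<open>g\<close>, rotated one step by \<open>f\<close>. For
  \<open>m = 1\<close> there are no rows to exchange and \<open>f\<close>, \<open>g\<close> are just \<open>t\<close> and the \<open>k\<close>-cycle.
\<close>

section \<open>Permutation groups and the transpositions they contain\<close>

lemma finite_endo_permutes:
  assumes "finite S" "f ` S \<subseteq> S" "inj_on f S" "\<And>x. x \<notin> S \<Longrightarrow> f x = x"
  shows "f permutes S"
  using assms by (intro bij_imp_permutes bij_betw_imageI endo_inj_surj)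

locale perm_group =
  fixes S :: "'b set" and H :: "('b \<Rightarrow> 'b) set"
  assumes fin: "finite S"
    and perm: "h \<in> H \<Longrightarrow> h permutes S"
    and id: "id \<in> H"
    and comp: "g \<in> H \<Longrightarrow> h \<in> H \<Longrightarrow> g \<circ> h \<in> H"
    and inv: "h \<in> H \<Longrightarrow> inv_into UNIV h \<in> H"
begin

lemma funpow: "h \<in> H \<Longrightarrow> h ^^ l \<in> H"
  by (induction l) (auto simp: id comp)

text \<open>The next two lemmas say that ``\<open>(x y)\<close> lies in \<open>H\<close>'' is an \<open>H\<close>-invariant and transitive
  relation; transitivity is the case of conjugation by \<open>(y z)\<close>.\<close>

lemma transpose_conj:
  assumes h: "h \<in> H" and t: "transpose x y \<in> H"
  shows "transpose (h x) (h y) \<in> H"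
proof -
  note p = perm[OF h]
  have "transpose (h x) (h y) = transpose (h x) (h y) \<circ> h \<circ> inv_into UNIV h"
    by (simp add: comp_assoc permutes_inv_o(1)[OF p])
  also have "\<dots> = h \<circ> transpose x y \<circ> inv_into UNIV h"
    by (simp add: transpose_comp_eq permutes_bij[OF p] permutes_inverses(2)[OF p])
  finally show ?thesis using h t by (simp add: comp inv)
qed

lemma transpose_trans:
  assumes xy: "transpose x y \<in> H" and yz: "transpose y z \<in> H"
  shows "transpose x z \<in> H"
proof (cases "x = z \<or> x = y \<or> y = z")
  case True
  then show ?thesis using assms id by auto
next
  case False
  then show ?thesis using transpose_conj[OF yz xy] by (simp add: transpose_apply_other)
qed

lemma transpose_sym: "transpose x y \<in> H \<Longrightarrow> transpose y x \<in> H"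
  by (simp add: transpose_commute)

lemma transpose_refl: "transpose x x \<in> H"
  by (simp add: id)

text \<open>The assumption concerns only each point and its own image, so that the lemma applies both to
  arbitrary permutations of the rows and to permutations that keep every row. Multiplying
  \<open>p\<close> by such a transposition fixes one more point and keeps the assumption, because the relation
  is transitive.\<close>

lemma mem_if_transposes:
  assumes "p permutes S" and "\<And>x. x \<in> S \<Longrightarrow> transpose x (p x) \<in> H"
  shows "p \<in> H"
  using assms
proof (induction "card {x \<in> S. p x \<noteq> x}" arbitrary: p rule: less_induct)
  case less
  show ?case
  proof (cases "\<exists>x\<in>S. p x \<noteq> x")
    case False
    then have "p x = x" for x using permutes_not_in[OF less.prems(1), of x] by blast
    then have "p = id" by (simp add: fun_eq_iff)
    then show ?thesis by (simp add: id)
  next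
    case True
    then obtain x where x: "x \<in> S" "p x \<noteq> x" by blast
    have px: "p x \<in> S" using x less.prems(1) by (simp add: permutes_in_image)
    define q where "q = transpose x (p x) \<circ> p"
    have q: "q permutes S" unfolding q_def
      by (intro permutes_compose permutes_swap_id less.prems x px)
    have inj: "p y = p x \<longleftrightarrow> y = x" for y
      using permutes_inj[OF less.prems(1)] by (auto dest: injD)
    have moved: "{y \<in> S. q y \<noteq> y} \<subset> {y \<in> S. p y \<noteq> y}"
    proof
      show "{y \<in> S. q y \<noteq> y} \<subseteq> {y \<in> S. p y \<noteq> y}"
        by (auto simp: q_def transpose_def inj)
      have "q x = x" by (simp add: q_def)
      then have "x \<notin> {y \<in> S. q y \<noteq> y}" by simp
      moreover have "x \<in> {y \<in> S. p y \<noteq> y}" using x by simp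
      ultimately show "{y \<in> S. q y \<noteq> y} \<noteq> {y \<in> S. p y \<noteq> y}" by metis
    qed
    have "transpose y (q y) \<in> H" if y: "y \<in> S" for y
    proof -
      consider "y = x" | "p y = x" | "y \<noteq> x" "p y \<noteq> x" by blast
      then show ?thesis
      proof cases
        case 1
        then have "q y = y" by (simp add: q_def)
        then show ?thesis by (simp add: id)
      next
        case 2
        then have "q y = p x" by (simp add: q_def)
        moreover have "transpose y x \<in> H" using less.prems(2)[OF y] 2 by simp
        ultimately show ?thesis using transpose_trans[OF _ less.prems(2)[OF x(1)]] by simp
      next
        case 3
        then have "q y = p y" using inj by (simp add: q_def transpose_apply_other)
        then show ?thesis using less.prems(2)[OF y] by simp
      qed
    qed
    then have "q \<in> H"
      using less.hyps[OF psubset_card_mono[OF _ moved] q] fin by simp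
    then have "transpose x (p x) \<circ> q \<in> H" using less.prems(2)[OF x(1)] comp by blast
    also have "transpose x (p x) \<circ> q = p" by (simp add: q_def fun_eq_iff)
    finally show ?thesis .
  qed
qed

end

section \<open>Relations invariant under a long cycle\<close>

definition rot :: "nat \<Rightarrow> nat \<Rightarrow> nat" where
  "rot k i = (if i < k then Suc i mod k else i)"

lemma rot_permutes:
  assumes "k \<le> N"
  shows "rot k permutes {..<N}"
proof -
  have "inj_on (rot k) {..<N}"
    by (auto simp: inj_on_def rot_def mod_Suc split: if_splits)
  moreover have "rot k ` {..<N} \<subseteq> {..<N}"
    using assms by (auto simp: rot_def mod_Suc)
  ultimately show ?thesis using assms
    by (intro finite_endo_permutes) (auto simp: rot_def)
qed

lemma rot_funpow: "i < k \<Longrightarrow> (rot k ^^ l) i = (i + l) mod k"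
  by (induction l) (auto simp: rot_def mod_Suc_eq)

lemma rot_funpow_fix: "k \<le> i \<Longrightarrow> (rot k ^^ l) i = i"
  by (induction l) (auto simp: rot_def)

lemma rot_funpow_self: "rot k ^^ k = id"
proof
  fix i show "(rot k ^^ k) i = id i"
    by (cases "i < k") (auto simp: rot_funpow rot_funpow_fix)
qed

text \<open>For \<open>k = N\<close> the pair \<open>(0, N - 1)\<close> is adjacent on the cycle, so its translates link all
  points into a path. For \<open>k = N - 1\<close> the point \<open>N - 1\<close> is fixed while \<open>0\<close> runs through all other
  points, so the translates form a star with centre \<open>N - 1\<close>. Admitting both lengths lets an odd
  cycle be used for every \<open>N\<close>.\<close>

lemma rot_invariant_rel_total:
  assumes refl: "\<And>i. R i i" and sym: "\<And>i j. R i j \<Longrightarrow> R j i"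
    and trans: "\<And>i j l. R i j \<Longrightarrow> R j l \<Longrightarrow> R i l"
    and ends: "R 0 (N - 1)"
    and rot: "\<And>i j. i < N \<Longrightarrow> j < N \<Longrightarrow> R i j \<Longrightarrow> R (rot k i) (rot k j)"
    and k: "k = N \<or> Suc k = N"
    and ij: "i < N" "j < N"
  shows "R i j"
proof -
  have N: "0 < N" using ij by simp
  have pow: "R ((rot k ^^ l) 0) ((rot k ^^ l) (N - 1))" for l
  proof (induction l)
    case 0
    then show ?case using ends by simp
  next
    case (Suc l)
    have "rot k i < N \<longleftrightarrow> i < N" for i
      using permutes_in_image[OF rot_permutes[of k N], of i] k by auto
    then have "(rot k ^^ l) i < N \<longleftrightarrow> i < N" for i
      by (induction l) auto
    then have "R (rot k ((rot k ^^ l) 0)) (rot k ((rot k ^^ l) (N - 1)))"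
      using rot[OF _ _ Suc] N by simp
    then show ?case by simp
  qed
  have "R 0 i" if "i < N" for i
    using k
  proof
    assume kN: "k = N"
    show ?thesis using that
    proof (induction i)
      case (Suc i)
      have "N - 1 + Suc i = i + N" using N by simp
      then have "(rot k ^^ Suc i) (N - 1) = i"
        using rot_funpow[of "N - 1" k "Suc i"] Suc.prems kN by (simp del: funpow.simps)
      moreover have "(rot k ^^ Suc i) 0 = Suc i"
        using rot_funpow[of 0 k "Suc i"] Suc.prems kN by (simp del: funpow.simps)
      ultimately have "R (Suc i) i" using pow[of "Suc i"] by metis
      then show ?case using trans[OF Suc.IH sym] Suc.prems by simp
    qed (rule refl)
  next
    assume kN: "Suc k = N"
    have "R i (N - 1)" if "i < k" for i
      using pow[of i] that kN by (auto simp: rot_funpow rot_funpow_fix)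
    moreover have "i < k \<or> i = N - 1" using that kN by auto
    ultimately show ?thesis using ends trans[OF ends sym] by blast
  qed
  then have "R 0 i" "R 0 j" using ij by blast+
  then show ?thesis using trans[OF sym] by blast
qed

section \<open>Row-preserving permutations of a grid\<close>

abbreviation grid :: "nat \<Rightarrow> nat \<Rightarrow> (nat \<times> nat) set" where
  "grid m n \<equiv> {..<m} \<times> {..<n}"

definition row_perms :: "nat \<Rightarrow> nat \<Rightarrow> (nat \<times> nat \<Rightarrow> nat \<times> nat) set" where
  "row_perms m n = {p. p permutes grid m n \<and>
     (\<forall>i<m. \<forall>j<n. \<forall>j'<n. fst (p (i, j)) = fst (p (i, j')))}"

definition induces :: "nat \<Rightarrow> nat \<Rightarrow> (nat \<times> nat \<Rightarrow> nat \<times> nat) \<Rightarrow> (nat \<Rightarrow> nat) \<Rightarrow> bool" where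
  "induces m n p \<pi> \<longleftrightarrow> \<pi> permutes {..<m} \<and> (\<forall>i<m. \<forall>j<n. fst (p (i, j)) = \<pi> i)"

lemma row_perms_induces:
  assumes p: "p \<in> row_perms m n" and n: "0 < n"
  obtains \<pi> where "induces m n p \<pi>"
proof
  let ?\<pi> = "\<lambda>i. if i < m then fst (p (i, 0)) else i"
  have pp: "p permutes grid m n" using p by (simp add: row_perms_def)
  have fst_p: "fst (p (i, j)) = ?\<pi> i" if "i < m" "j < n" for i j
  proof -
    have "fst (p (i, j)) = fst (p (i, 0))" using p that n unfolding row_perms_def by blast
    then show ?thesis using that(1) by presburger
  qed
  have into: "?\<pi> i < m" if "i < m" for i
    using permutes_in_image[OF pp, of "(i, 0)"] that n by (simp add: mem_Times_iff)
  have onto: "{..<m} \<subseteq> ?\<pi> ` {..<m}"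
  proof
    fix i assume "i \<in> {..<m}"
    then have "(i, 0) \<in> p ` grid m n" using permutes_image[OF pp] n by simp
    then obtain a c where ac: "a < m" "c < n" "p (a, c) = (i, 0)" by force
    then have "i = ?\<pi> a" using fst_p[of a c] by simp
    then show "i \<in> ?\<pi> ` {..<m}" using ac(1) by (intro image_eqI[of _ _ a]) simp_all
  qed
  have "inj_on ?\<pi> {..<m}" by (rule finite_surj_inj[OF _ onto]) simp
  then have "?\<pi> permutes {..<m}"
    by (intro finite_endo_permutes) (use into in auto)
  then show "induces m n p ?\<pi>" unfolding induces_def using fst_p by blast
qed

text \<open>This makes the lemmas on transpositions available for the action on the rows.\<close>

lemma induced_perm_group:
  assumes "perm_group (grid m n) H"
  shows "perm_group {..<m} {\<pi>. \<exists>h\<in>H. induces m n h \<pi>}"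
proof -
  interpret H: perm_group "grid m n" H by fact
  have grid: "h (i, j) \<in> grid m n" if "h \<in> H" "i < m" "j < n" for h i j
    using permutes_in_image[OF H.perm[OF that(1)]] that by simp
  show ?thesis
  proof (unfold_locales; (elim CollectE bexE)?)
    show "id \<in> {\<pi>. \<exists>h\<in>H. induces m n h \<pi>}"
      using H.id by (auto simp: induces_def permutes_id intro!: bexI[of _ id])
  next
    fix \<pi> \<rho> g h
    assume g: "g \<in> H" "induces m n g \<pi>" and h: "h \<in> H" "induces m n h \<rho>"
    have "fst (g (h (i, j))) = \<pi> (\<rho> i)" if "i < m" "j < n" for i j
    proof -
      obtain a c where ac: "h (i, j) = (a, c)" by fastforce
      then have "a < m" "c < n" using grid[OF h(1) that] by auto
      then have "fst (g (a, c)) = \<pi> a" using g(2) by (simp add: induces_def)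
      moreover have "a = \<rho> i" using h(2) that ac unfolding induces_def by fastforce
      ultimately show ?thesis using ac by simp
    qed
    then have "induces m n (g \<circ> h) (\<pi> \<circ> \<rho>)"
      using g(2) h(2) by (simp add: induces_def permutes_compose)
    then show "\<pi> \<circ> \<rho> \<in> {\<pi>. \<exists>h\<in>H. induces m n h \<pi>}" using H.comp[OF g(1) h(1)] by blast
  next
    fix \<pi> h assume h: "h \<in> H" "induces m n h \<pi>"
    then have \<pi>: "\<pi> permutes {..<m}" by (simp add: induces_def)
    have "fst (inv_into UNIV h (i, j)) = inv_into UNIV \<pi> i" if "i < m" "j < n" for i j
    proof -
      obtain a c where ac: "inv_into UNIV h (i, j) = (a, c)" by fastforce
      then have "h (a, c) = (i, j)" using permutes_inverses(1)[OF H.perm[OF h(1)]] by metis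
      moreover have "a < m" "c < n" using grid[OF H.inv[OF h(1)] that] ac by auto
      ultimately have "\<pi> a = i" using h(2) unfolding induces_def by (metis fst_conv)
      then show ?thesis using permutes_inverses(2)[OF \<pi>] ac by auto
    qed
    then have "induces m n (inv_into UNIV h) (inv_into UNIV \<pi>)"
      using permutes_inv[OF \<pi>] by (simp add: induces_def)
    then show "inv_into UNIV \<pi> \<in> {\<pi>. \<exists>h\<in>H. induces m n h \<pi>}" using H.inv[OF h(1)] by blast
  qed (auto simp: induces_def)
qed

text \<open>Dividing a row-preserving permutation by an element of \<open>H\<close> with the same action on the rows
  leaves a permutation within rows, which is a product of the given transpositions.\<close>

lemma row_perms_subset:
  assumes H: "perm_group (grid m n) H" and n: "0 < n"
    and rows: "\<And>\<pi>. \<pi> permutes {..<m} \<Longrightarrow> \<exists>h\<in>H. induces m n h \<pi>"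
    and entries: "\<And>i j j'. i < m \<Longrightarrow> j < n \<Longrightarrow> j' < n \<Longrightarrow> transpose (i, j) (i, j') \<in> H"
  shows "row_perms m n \<subseteq> H"
proof
  interpret H: perm_group "grid m n" H by fact
  fix p assume p: "p \<in> row_perms m n"
  then have pp: "p permutes grid m n" by (simp add: row_perms_def)
  obtain \<pi> where \<pi>: "induces m n p \<pi>" using row_perms_induces[OF p n] .
  then have "\<pi> permutes {..<m}" by (simp add: induces_def)
  then obtain h where h: "h \<in> H" "induces m n h \<pi>" using rows by blast
  note hp = H.perm[OF h(1)]
  define q where "q = inv_into UNIV h \<circ> p"
  have q: "q permutes grid m n"
    unfolding q_def by (intro permutes_compose pp permutes_inv hp)
  have hq: "h \<circ> q = p" by (simp add: q_def fun_eq_iff permutes_inverses(1)[OF hp])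
  have "transpose x (q x) \<in> H" if x: "x \<in> grid m n" for x
  proof -
    obtain i j where ij: "x = (i, j)" "i < m" "j < n" using x by auto
    obtain a c where ac: "q x = (a, c)" by fastforce
    then have ac': "a < m" "c < n" using permutes_in_image[OF q, of x] x by auto
    have "h (a, c) = p (i, j)" using hq ac ij(1) by (metis comp_apply)
    then have "\<pi> a = \<pi> i" using \<pi> h(2) ij ac' unfolding induces_def by metis
    then have "a = i" using \<pi> unfolding induces_def by (metis permutes_inj injD)
    then show ?thesis using entries ij ac ac' by simp
  qed
  then have "q \<in> H" by (rule H.mem_if_transposes[OF q])
  then show "p \<in> H" using H.comp[OF h(1)] hq by metis
qed

text \<open>The criterion for the generators: the row exchange and the entry exchange are spread by the
  rotations to all pairs of rows and to all pairs of entries of row \<open>b\<close>. From there they reach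
  every other row by conjugation with an element of \<open>H\<close> that moves \<open>b\<close> to that row.\<close>

lemma row_perms_subset_if_rotations:
  assumes H: "perm_group (grid m n) H" and n: "0 < n" and b: "b < m"
    and row_rot: "f \<in> H" "induces m n f (rot k)" "k = m \<or> Suc k = m"
    and row_swap: "g \<in> H" "induces m n g (transpose 0 (m - 1))"
    and rot: "h \<in> H" "\<And>j. j < n \<Longrightarrow> h (b, j) = (b, rot l j)" "l = n \<or> Suc l = n"
    and swap: "transpose (b, 0) (b, n - 1) \<in> H"
  shows "row_perms m n \<subseteq> H"
proof -
  interpret H: perm_group "grid m n" H by fact
  define K where "K = {\<pi>. \<exists>h\<in>H. induces m n h \<pi>}"
  interpret K: perm_group "{..<m}" K unfolding K_def by (rule induced_perm_group[OF H])
  have K_rot: "rot k \<in> K" and K_swap: "transpose 0 (m - 1) \<in> K"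
    using row_rot row_swap by (auto simp: K_def)
  have K_transpose: "transpose i i' \<in> K" if "i < m" "i' < m" for i i'
    by (rule rot_invariant_rel_total[where R = "\<lambda>i i'. transpose i i' \<in> K" and k = k and N = m,
          OF K.transpose_refl K.transpose_sym K.transpose_trans K_swap K.transpose_conj[OF K_rot]
             row_rot(3) that])
  have rows: "\<exists>h\<in>H. induces m n h \<pi>" if "\<pi> permutes {..<m}" for \<pi>
  proof -
    have "\<pi> \<in> K"
    proof (rule K.mem_if_transposes[OF that])
      fix i assume "i \<in> {..<m}"
      then show "transpose i (\<pi> i) \<in> K"
        using K_transpose permutes_in_image[OF that, of i] by blast
    qed
    then show ?thesis by (simp add: K_def)
  qed
  have shift: "transpose (b, rot l j) (b, rot l j') \<in> H"
    if "j < n" "j' < n" "transpose (b, j) (b, j') \<in> H" for j j'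
    using H.transpose_conj[OF rot(1) that(3)] rot(2) that(1,2) by simp
  have entries_b: "transpose (b, j) (b, j') \<in> H" if "j < n" "j' < n" for j j'
    by (rule rot_invariant_rel_total[where R = "\<lambda>j j'. transpose (b, j) (b, j') \<in> H"
          and k = l and N = n,
          OF H.transpose_refl H.transpose_sym H.transpose_trans swap shift rot(3) that])
  have "transpose (i, j) (i, j') \<in> H" if i: "i < m" and j: "j < n" "j' < n" for i j j'
  proof -
    have "transpose b i \<in> K" using K_transpose b i by blast
    then obtain u where u: "u \<in> H" "induces m n u (transpose b i)" by (auto simp: K_def)
    note up = H.perm[OF u(1)]
    have from_b: "\<exists>a<n. u (b, a) = (i, c)" if c: "c < n" for c
    proof -
      have "(i, c) \<in> u ` grid m n" using permutes_image[OF up] i c by simp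
      then obtain x y where xy: "x < m" "y < n" "u (x, y) = (i, c)" by force
      then have "transpose b i x = i" using u(2) unfolding induces_def by (metis fst_conv)
      then have "x = b" by (metis transpose_apply_second transpose_involutory)
      then show ?thesis using xy by blast
    qed
    then obtain a a' where "a < n" "u (b, a) = (i, j)" "a' < n" "u (b, a') = (i, j')"
      using j by meson
    then show ?thesis using H.transpose_conj[OF u(1) entries_b[of a a']] by simp
  qed
  then show ?thesis using row_perms_subset[OF H n rows] by blast
qed

section \<open>The two generators\<close>

text \<open>The element of the wreath product that moves row \<open>i\<close> to row \<open>\<sigma> i\<close> and applies \<open>\<tau> i\<close> on the
  way. Points beyond column \<open>n\<close> must be left alone even in rows that \<open>\<sigma>\<close> moves, since otherwise the
  result would not be a permutation of the grid.\<close>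

definition wreath :: "nat \<Rightarrow> (nat \<Rightarrow> nat) \<Rightarrow> (nat \<Rightarrow> nat \<Rightarrow> nat) \<Rightarrow> nat \<times> nat \<Rightarrow> nat \<times> nat" where
  "wreath n \<sigma> \<tau> = (\<lambda>(i, j). if j < n then (\<sigma> i, \<tau> i j) else (i, j))"

lemma wreath_apply [simp]:
  "j < n \<Longrightarrow> wreath n \<sigma> \<tau> (i, j) = (\<sigma> i, \<tau> i j)"
  "\<not> j < n \<Longrightarrow> wreath n \<sigma> \<tau> (i, j) = (i, j)"
  by (simp_all add: wreath_def)

lemma wreath_row_perms:
  assumes \<sigma>: "\<sigma> permutes {..<m}" and \<tau>: "\<And>i. \<tau> i permutes {..<n}"
    and id: "\<And>i. m \<le> i \<Longrightarrow> \<tau> i = id"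
  shows "wreath n \<sigma> \<tau> \<in> row_perms m n" "induces m n (wreath n \<sigma> \<tau>) \<sigma>"
proof -
  have \<sigma>_lt: "\<sigma> i < m" if "i < m" for i using permutes_in_image[OF \<sigma>, of i] that by simp
  have \<tau>_lt: "\<tau> i j < n" if "j < n" for i j using permutes_in_image[OF \<tau>[of i], of j] that by simp
  have "inj_on (wreath n \<sigma> \<tau>) (grid m n)"
    by (auto simp: inj_on_def inj_eq[OF permutes_inj[OF \<sigma>]] inj_eq[OF permutes_inj[OF \<tau>]])
  moreover have "wreath n \<sigma> \<tau> ` grid m n \<subseteq> grid m n"
    using \<sigma>_lt \<tau>_lt by auto
  moreover have "wreath n \<sigma> \<tau> x = x" if "x \<notin> grid m n" for x
    using that permutes_not_in[OF \<sigma>] id by (cases x) (auto simp: wreath_def)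
  ultimately have "wreath n \<sigma> \<tau> permutes grid m n"
    by (intro finite_endo_permutes) auto
  then show "wreath n \<sigma> \<tau> \<in> row_perms m n" "induces m n (wreath n \<sigma> \<tau>) \<sigma>"
    using \<sigma> by (auto simp: row_perms_def induces_def)
qed

lemma transpose_funpow: "transpose a b ^^ l = (if odd l then transpose a b else id)"
  by (induction l) (auto simp: fun_eq_iff)

text \<open>For even \<open>m\<close> the odd power \<open>m - 1\<close> kills the row rotation of \<open>f\<close> but keeps the transposition
  on the last row, which that rotation does not touch.\<close>

lemma even_generators:
  assumes m: "even m" "0 < m" and n: "0 < n"
  shows "\<exists>f\<in>row_perms m n. \<exists>g\<in>row_perms m n. \<forall>H. perm_group (grid m n) H \<longrightarrow>
    f \<in> H \<longrightarrow> g \<in> H \<longrightarrow> row_perms m n \<subseteq> H"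
proof -
  define t where "t = transpose 0 (n - 1)"
  define f where "f = wreath n (rot (m - 1)) (\<lambda>i. if i = m - 1 then t else id)"
  define g where "g = wreath n (transpose 0 (m - 1)) (\<lambda>i. if i = 0 then rot n else id)"
  have "m \<noteq> 1" using m by auto
  then have m2: "m - 1 \<noteq> 0" using m by simp
  have t: "t permutes {..<n}" unfolding t_def using n by (intro permutes_swap_id) auto
  have tn: "(t ^^ l) j < n" if "j < n" for l j
    by (induction l) (use permutes_in_image[OF t] that in auto)
  have f: "f \<in> row_perms m n" "induces m n f (rot (m - 1))"
    unfolding f_def using t m by (auto intro!: wreath_row_perms rot_permutes permutes_id)
  have g: "g \<in> row_perms m n" "induces m n g (transpose 0 (m - 1))"
    unfolding g_def using m
    by (auto intro!: wreath_row_perms rot_permutes permutes_id permutes_swap_id)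
  have f_row: "(f ^^ l) (m - 1, j) = (m - 1, (t ^^ l) j)" if "j < n" for l j
    by (induction l) (use that tn in \<open>auto simp: f_def rot_def\<close>)
  have f_other: "(f ^^ l) (i, j) = ((rot (m - 1) ^^ l) i, j)" if "i < m - 1" "j < n" for l i j
  proof (induction l)
    case (Suc l)
    have "(rot (m - 1) ^^ l) i < m - 1" using rot_funpow[of i "m - 1" l] that by simp
    then show ?case using Suc that by (simp add: f_def)
  qed simp
  have f_pow: "f ^^ (m - 1) = transpose (m - 1, 0) (m - 1, n - 1)"
  proof
    fix x :: "nat \<times> nat"
    obtain i j where x: "x = (i, j)" by fastforce
    consider "m \<le> i \<or> n \<le> j" | "i = m - 1" "j < n" | "i < m - 1" "j < n" by linarith
    then show "(f ^^ (m - 1)) x = transpose (m - 1, 0) (m - 1, n - 1) x"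
    proof cases
      case 1
      then have "f x = x"
        using f(1) permutes_not_in[of f "grid m n" x] by (auto simp: row_perms_def x)
      then have "(f ^^ l) x = x" for l by (induction l) auto
      then show ?thesis using 1 m n by (auto simp: x transpose_def)
    next
      case 2
      have "t ^^ (m - 1) = t" unfolding t_def transpose_funpow using m by auto
      then show ?thesis using f_row[OF 2(2)] 2 by (auto simp: x t_def transpose_def)
    next
      case 3
      then show ?thesis
        using f_other[OF 3, of "m - 1"] by (auto simp: x rot_funpow_self transpose_def)
    qed
  qed
  have g_row: "(g ^^ 2) (m - 1, j) = (m - 1, rot n j)" if "j < n" for j
    using that m2 by (simp add: g_def numeral_2_eq_2)
  have "row_perms m n \<subseteq> H" if H: "perm_group (grid m n) H" and fg: "f \<in> H" "g \<in> H" for H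
  proof -
    interpret H: perm_group "grid m n" H by fact
    show ?thesis
    proof (rule row_perms_subset_if_rotations[OF H n _ fg(1) f(2) _ fg(2) g(2) H.funpow[OF fg(2)] g_row])
      show "transpose (m - 1, 0) (m - 1, n - 1) \<in> H" using H.funpow[OF fg(1)] f_pow by metis
    qed (use m in auto)
  qed
  with f g show ?thesis by blast
qed

text \<open>For odd \<open>m\<close> the maps \<open>T A\<close> in the proof apply \<open>t\<close> to the rows in \<open>A\<close>. They multiply by symmetric
  difference, and \<open>f\<close> conjugates them by shifting \<open>A\<close>, since its own twist \<open>t\<close> commutes with \<open>t\<close>. So
  the sets \<open>A\<close> with \<open>T A\<close> in the group can be handled like vectors over the field with two
  elements.

  Where \<open>m = 1\<close>, truncated subtraction makes \<open>m - 2\<close> and \<open>m - 1\<close> both \<open>0\<close>, so the row exchange of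
  \<open>g\<close> is the identity and only its cycle on row \<open>0\<close> remains.\<close>

lemma odd_generators:
  assumes m: "odd m" and n: "0 < n"
  shows "\<exists>f\<in>row_perms m n. \<exists>g\<in>row_perms m n. \<forall>H. perm_group (grid m n) H \<longrightarrow>
    f \<in> H \<longrightarrow> g \<in> H \<longrightarrow> row_perms m n \<subseteq> H"
proof -
  define t where "t = transpose 0 (n - 1)"
  define k where "k = (if odd n then n else n - 1)"
  define f where "f = wreath n (rot m) (\<lambda>i. if i = m - 1 then t else id)"
  define g where "g = wreath n (transpose (m - 2) (m - 1))
    (\<lambda>i. if i = 0 then rot k else if i = m - 1 then t else id)"
  define T where "T A = (\<lambda>(i::nat, j). (i, if i \<in> A then t j else j))" for A
  have m0: "0 < m" using m by (cases m) auto
  have "m \<noteq> 2" using m by auto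
  then have m3: "m = 1 \<or> 3 \<le> m" using m0 by linarith
  have k: "odd k" "k = n \<or> Suc k = n" using n by (auto simp: k_def)
  have t: "t permutes {..<n}" unfolding t_def using n by (intro permutes_swap_id) auto
  have t_lt: "t j < n" if "j < n" for j using permutes_in_image[OF t, of j] that by simp
  have t_ge: "t j = j" if "n \<le> j" for j using permutes_not_in[OF t, of j] that by simp
  have tt: "t (t j) = j" for j by (simp add: t_def)
  have v: "rot k permutes {..<n}" using k by (intro rot_permutes) auto
  have v_lt: "rot k j < n" if "j < n" for j using permutes_in_image[OF v, of j] that by simp
  have f: "f \<in> row_perms m n" "induces m n f (rot m)"
    unfolding f_def using t m0 by (auto intro!: wreath_row_perms rot_permutes permutes_id)
  have g: "g \<in> row_perms m n" "induces m n g (transpose (m - 2) (m - 1))"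
    unfolding g_def using m0 t v
    by (auto intro!: wreath_row_perms permutes_id permutes_swap_id)
  have outside: "(p ^^ l) (i, j) = (i, j)"
    if "p \<in> row_perms m n" "\<not> (i < m \<and> j < n)" for p l i j
  proof -
    have "p (i, j) = (i, j)"
      using that permutes_not_in[of p "grid m n" "(i, j)"] by (auto simp: row_perms_def)
    then show ?thesis by (induction l) auto
  qed
  have f_step: "(f ^^ l) (i, j) = (i + l, j)" if "i + l < m" "j < n" for i j l
    using that by (induction l) (auto simp: f_def rot_def)
  have f_pow: "f ^^ m = T {..<m}"
  proof
    fix x :: "nat \<times> nat"
    obtain i j where x: "x = (i, j)" by fastforce
    show "(f ^^ m) x = T {..<m} x"
    proof (cases "i < m \<and> j < n")
      case False
      then show ?thesis using outside[OF f(1) False] t_ge by (auto simp: x T_def)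
    next
      case True
      \<comment> \<open>Starting in row \<open>i\<close>, the twist is met only at the step from the last row to row \<open>0\<close>.\<close>
      have "f ^^ m = f ^^ i \<circ> f \<circ> f ^^ (m - 1 - i)"
      proof -
        have "f ^^ (i + Suc (m - 1 - i)) = f ^^ i \<circ> f \<circ> f ^^ (m - 1 - i)"
          by (simp only: funpow_add funpow.simps comp_assoc)
        moreover have "i + Suc (m - 1 - i) = m" using True by simp
        ultimately show ?thesis by simp
      qed
      then have "(f ^^ m) x = (f ^^ i) (f ((f ^^ (m - 1 - i)) (i, j)))" by (simp add: x)
      also have "\<dots> = (f ^^ i) (f (m - 1, j))" using f_step[of i "m - 1 - i" j] True by simp
      also have "f (m - 1, j) = (0, t j)" using True by (simp add: f_def rot_def)
      also have "(f ^^ i) (0, t j) = (i, t j)" using f_step[of 0 i "t j"] True t_lt by simp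
      finally show ?thesis using True by (simp add: x T_def)
    qed
  qed
  define \<tau> where "\<tau> i = (if i = 0 then rot k \<circ> rot k else if i = m - 2 \<or> i = m - 1 then t else id)" for i
  have \<tau>_lt: "\<tau> i j < n" if "j < n" for i j using that t_lt v_lt by (simp add: \<tau>_def)
  have g_sq: "(g ^^ 2) (i, j) = (i, \<tau> i j)" if "j < n" for i j
    using that m3 by (auto simp: g_def \<tau>_def numeral_2_eq_2 t_lt v_lt transpose_def)
  have g_sq_pow: "((g ^^ 2) ^^ l) (i, j) = (i, (\<tau> i ^^ l) j)" if "j < n" for i j l
  proof -
    have "((g ^^ 2) ^^ l) (i, j) = (i, (\<tau> i ^^ l) j) \<and> (\<tau> i ^^ l) j < n"
    proof (induction l)
      case (Suc l)
      then show ?case using g_sq \<tau>_lt by (simp only: funpow.simps comp_apply)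
    qed (simp add: that)
    then show ?thesis by blast
  qed
  have g_pow: "(g ^^ 2) ^^ k = T ({m - 2, m - 1} - {0})"
  proof
    fix x :: "nat \<times> nat"
    obtain i j where x: "x = (i, j)" by fastforce
    show "((g ^^ 2) ^^ k) x = T ({m - 2, m - 1} - {0}) x"
    proof (cases "i < m \<and> j < n")
      case False
      then show ?thesis
        using outside[OF g(1) False, of "2 * k"] t_ge m0 by (auto simp: x T_def funpow_mult)
    next
      case True
      have "(rot k \<circ> rot k) ^^ k = id"
      proof -
        have "(rot k ^^ 2) ^^ k = (rot k ^^ k) ^^ 2" by (simp only: funpow_mult mult.commute)
        also have "\<dots> = id" by (simp add: rot_funpow_self)
        finally show ?thesis by (simp add: numeral_2_eq_2)
      qed
      moreover have "t ^^ k = t" using k by (simp add: t_def transpose_funpow)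
      moreover have "id ^^ k = (id :: nat \<Rightarrow> nat)" by simp
      ultimately show ?thesis using g_sq_pow[of j k i] True by (auto simp: x T_def \<tau>_def)
    qed
  qed
  have f_T: "f \<circ> T A = T (Suc ` A) \<circ> f" if A: "A \<subseteq> {..<m - 1}" for A
  proof
    fix x :: "nat \<times> nat"
    obtain i j where x: "x = (i, j)" by fastforce
    consider "\<not> (i < m \<and> j < n)" | "i = m - 1" "j < n" | "i < m - 1" "j < n" by linarith
    then show "(f \<circ> T A) x = (T (Suc ` A) \<circ> f) x"
    proof cases
      case 1
      then show ?thesis using outside[OF f(1) 1, of 1] A t_ge by (auto simp: x T_def)
    next
      case 2
      then have "m - 1 \<notin> A" "rot m (m - 1) = 0" using A m0 by (auto simp: rot_def)
      then show ?thesis using 2 by (auto simp: x T_def f_def)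
    next
      case 3
      then have "rot m i = Suc i" by (auto simp: rot_def)
      then show ?thesis using 3 t_lt by (auto simp: x T_def f_def)
    qed
  qed
  have "row_perms m n \<subseteq> H" if H: "perm_group (grid m n) H" and fg: "f \<in> H" "g \<in> H" for H
  proof -
    interpret H: perm_group "grid m n" H by fact
    define K where "K = {\<pi>. \<exists>h\<in>H. induces m n h \<pi>}"
    interpret K: perm_group "{..<m}" K unfolding K_def by (rule induced_perm_group[OF H])
    have "rot m \<in> K" "transpose (m - 2) (m - 1) \<in> K"
      unfolding K_def using fg f(2) g(2) by blast+
    then have "transpose (rot m (m - 2)) (rot m (m - 1)) \<in> K" by (rule K.transpose_conj)
    moreover have "rot m (m - 1) = 0" using m0 by (simp add: rot_def)
    moreover have "rot m (m - 2) = m - 1" if "3 \<le> m"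
      using that by (simp add: rot_def Suc_diff_Suc numeral_2_eq_2)
    ultimately have "transpose 0 (m - 1) \<in> K"
      using m3 K.transpose_refl K.transpose_sym by (metis diff_self_eq_0)
    then obtain h where h: "h \<in> H" "induces m n h (transpose 0 (m - 1))"
      unfolding K_def by blast
    \<comment> \<open>Shifting down from the last two rows avoids any wrap-around.\<close>
    have T_shift: "T A \<in> H" if A: "A \<subseteq> {..<m - 1}" "T (Suc ` A) \<in> H" for A
    proof -
      note p = H.perm[OF fg(1)]
      have "T A = inv_into UNIV f \<circ> (f \<circ> T A)"
        by (simp add: comp_assoc[symmetric] permutes_inv_o(2)[OF p])
      also have "\<dots> = inv_into UNIV f \<circ> (T (Suc ` A) \<circ> f)" using f_T[OF A(1)] by simp
      finally show ?thesis using H.comp H.inv fg A(2) by simp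
    qed
    have T_pair: "T {i, Suc i} \<in> H" if i: "Suc i < m" for i
    proof -
      have "i \<le> m - 2" using i by simp
      then show ?thesis
      proof (induction rule: inc_induct)
        case base
        have "{m - 2, m - 1} - {0} = {m - 2, Suc (m - 2)}" using i m3 by auto
        then show ?case using H.funpow[OF H.funpow[OF fg(2)]] g_pow by metis
      next
        case (step i)
        show ?case
        proof (rule T_shift)
          show "{i, Suc i} \<subseteq> {..<m - 1}" using step.hyps by auto
          show "T (Suc ` {i, Suc i}) \<in> H" using step.IH by simp
        qed
      qed
    qed
    \<comment> \<open>Remove the rows from the top, two at a time; an odd \<open>m\<close> leaves exactly row \<open>0\<close>.\<close>
    have "T {..<m - 2 * l} \<in> H" if "2 * l < m" for l
      using that
    proof (induction l)
      case 0
      then show ?case using H.funpow[OF fg(1)] f_pow by (metis diff_zero mult_0_right)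
    next
      case (Suc l)
      define r where "r = m - 2 * Suc l"
      have r: "m - 2 * l = Suc (Suc r)" "Suc r < m" using Suc.prems by (auto simp: r_def)
      have "T {..<r} = T {..<Suc (Suc r)} \<circ> T {r, Suc r}"
        by (auto simp: T_def fun_eq_iff tt)
      moreover have "T {..<Suc (Suc r)} \<in> H" using Suc r(1) by simp
      ultimately have "T {..<r} \<in> H" using H.comp[OF _ T_pair[OF r(2)]] by metis
      then show ?case by (simp add: r_def)
    qed
    from this[of "(m - 1) div 2"] have "T {0} \<in> H"
      using m by (auto elim!: oddE simp: lessThan_Suc)
    moreover have "T {0} = transpose (0, 0) (0, n - 1)"
      by (auto simp: T_def t_def transpose_def fun_eq_iff)
    ultimately have swap: "transpose (0, 0) (0, n - 1) \<in> H" by simp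
    have g_row: "g (0, j) = (0, rot k j)" if "j < n" for j
      using that m3 by (auto simp: g_def transpose_def)
    show ?thesis
      by (rule row_perms_subset_if_rotations[OF H n m0 fg(1) f(2) _ h fg(2) g_row k(2) swap]) simp
  qed
  with f g show ?thesis by blast
qed

lemma row_perms_two_generators:
  assumes "0 < m" "0 < n"
  shows "\<exists>f\<in>row_perms m n. \<exists>g\<in>row_perms m n. \<forall>H. perm_group (grid m n) H \<longrightarrow>
    f \<in> H \<longrightarrow> g \<in> H \<longrightarrow> row_perms m n \<subseteq> H"
  using assms even_generators odd_generators by (cases "even m") blast+

section \<open>Transport to a uniform partition\<close>

lemma uniform_partition_coordinates:
  assumes X: "finite X" "X \<noteq> {}" and P: "uniform_partition_on X P"
  obtains m n \<phi> where "0 < m" "0 < n" "bij_betw \<phi> (grid m n) X"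
    "\<And>x y. x \<in> grid m n \<Longrightarrow> y \<in> grid m n \<Longrightarrow> same_block P (\<phi> x) (\<phi> y) \<longleftrightarrow> fst x = fst y"
proof -
  have part: "partition_on X P" and card: "\<And>A B. A \<in> P \<Longrightarrow> B \<in> P \<Longrightarrow> card A = card B"
    using P unfolding uniform_partition_on_def by blast+
  have UP: "\<Union> P = X" and ne: "{} \<notin> P"
    using part by (auto simp: partition_on_def)
  have disj: "A = B" if "A \<in> P" "B \<in> P" "x \<in> A" "x \<in> B" for A B x
    using part that unfolding partition_on_def disjoint_def by blast
  have fin: "finite P" "\<And>B. B \<in> P \<Longrightarrow> finite B"
    using X(1) UP finite_UnionD[of P] finite_subset[of _ X] by blast+
  obtain B0 where B0: "B0 \<in> P" using UP X(2) by blast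
  define m n where "m = card P" and "n = card B0"
  have "B0 \<noteq> {}" using B0 ne by blast
  then have mn: "0 < m" "0 < n"
    using B0 fin unfolding m_def n_def card_gt_0_iff by blast+
  obtain \<beta> where \<beta>: "bij_betw \<beta> {..<m} P"
    using ex_bij_betw_nat_finite[OF fin(1)] by (auto simp: m_def atLeast0LessThan)
  have "\<exists>c. bij_betw c {..<n} B" if "B \<in> P" for B
    using ex_bij_betw_nat_finite[OF fin(2)[OF that]] card[OF that B0]
    unfolding n_def atLeast0LessThan by metis
  then obtain \<gamma> where \<gamma>: "\<And>B. B \<in> P \<Longrightarrow> bij_betw (\<gamma> B) {..<n} B" by metis
  define \<phi> where "\<phi> = (\<lambda>(i, j). \<gamma> (\<beta> i) j)"
  have \<beta>P: "\<beta> i \<in> P" if "i < m" for i using bij_betwE[OF \<beta>] that by blast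
  have \<beta>_inj: "i = i'" if "\<beta> i = \<beta> i'" "i < m" "i' < m" for i i'
    using inj_onD[OF bij_betw_imp_inj_on[OF \<beta>] that(1)] that by simp
  have \<phi>_mem: "\<phi> (i, j) \<in> \<beta> i" if "i < m" "j < n" for i j
    using bij_betwE[OF \<gamma>[OF \<beta>P[OF that(1)]]] that(2) by (simp add: \<phi>_def)
  have block: "same_block P (\<phi> (i, j)) (\<phi> (i', j')) \<longleftrightarrow> i = i'"
    if "i < m" "j < n" "i' < m" "j' < n" for i j i' j'
  proof
    assume "same_block P (\<phi> (i, j)) (\<phi> (i', j'))"
    then obtain B where "B \<in> P" "\<phi> (i, j) \<in> B" "\<phi> (i', j') \<in> B" by (auto simp: same_block_def)
    then have "\<beta> i = B" "\<beta> i' = B" using disj[OF \<beta>P _ \<phi>_mem] that by blast+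
    then show "i = i'" using \<beta>_inj that by simp
  next
    assume "i = i'"
    then show "same_block P (\<phi> (i, j)) (\<phi> (i', j'))"
      unfolding same_block_def using \<phi>_mem \<beta>P that by blast
  qed
  have "inj_on \<phi> (grid m n)"
  proof (rule inj_onI)
    fix x y assume xy: "x \<in> grid m n" "y \<in> grid m n" and eq: "\<phi> x = \<phi> y"
    obtain i j i' j' where ij: "x = (i, j)" "y = (i', j')" by fastforce
    have lt: "i < m" "j < n" "i' < m" "j' < n" using xy ij by auto
    have "same_block P (\<phi> x) (\<phi> x)" using block[of i j i j] lt ij by simp
    then have "i = i'" using block[OF lt] eq ij by simp
    moreover have "j = j'"
      using inj_onD[OF bij_betw_imp_inj_on[OF \<gamma>[OF \<beta>P[OF lt(1)]]], of j j'] eq lt ij \<open>i = i'\<close>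
      by (simp add: \<phi>_def)
    ultimately show "x = y" using ij by simp
  qed
  moreover have "\<phi> ` grid m n = X"
  proof (intro equalityI subsetI)
    fix x assume "x \<in> \<phi> ` grid m n"
    then obtain i j where "i < m" "j < n" "x = \<phi> (i, j)" by auto
    then show "x \<in> X" using \<phi>_mem \<beta>P UP by blast
  next
    fix x assume "x \<in> X"
    then obtain B where B: "B \<in> P" "x \<in> B" using UP by blast
    then obtain i where i: "i < m" "\<beta> i = B" using bij_betw_imp_surj_on[OF \<beta>] by blast
    have "x \<in> \<gamma> B ` {..<n}" using bij_betw_imp_surj_on[OF \<gamma>[OF B(1)]] B(2) by simp
    then obtain j where j: "j < n" "\<gamma> B j = x" by blast
    have "x = \<phi> (i, j)" using i j by (simp add: \<phi>_def)
    then show "x \<in> \<phi> ` grid m n" using i(1) j(1) by blast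
  qed
  ultimately have "bij_betw \<phi> (grid m n) X" by (intro bij_betw_imageI)
  moreover have "same_block P (\<phi> x) (\<phi> y) \<longleftrightarrow> fst x = fst y"
    if "x \<in> grid m n" "y \<in> grid m n" for x y
    using block[of "fst x" "snd x" "fst y" "snd y"] that by (simp add: mem_Times_iff)
  ultimately show ?thesis by (intro that[OF mn])
qed

lemma carrier_partition_perm_group:
  "e \<in> carrier (partition_perm_group X P) \<longleftrightarrow> e \<in> extensional X \<and> bij_betw e X X \<and>
    (\<forall>x\<in>X. \<forall>y\<in>X. same_block P x y \<longrightarrow> same_block P (e x) (e y))"
  by (auto simp: partition_perm_group_def Bij_def)

text \<open>Through the coordinates \<open>\<phi>\<close>, row-preserving permutations of the grid correspond bijectively to
  the elements of the group. As the group product applies its left factor first, this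
  correspondence \<open>\<Phi>\<close> is an anti-homomorphism; that does not affect which elements two given ones
  generate. The permutations of the grid that \<open>\<Phi>\<close> sends into the generated subgroup therefore form a
  group to which the result on the grid applies.\<close>

theorem theorem4p1:
  fixes X :: "'a set" and P :: "'a set set"
  assumes "finite X" and "card X \<ge> 3"
    and "uniform_partition_on X P"
  shows "\<exists>f \<in> carrier (partition_perm_group X P). \<exists>g \<in> carrier (partition_perm_group X P).
    generate (partition_perm_group X P) {f, g} = carrier (partition_perm_group X P)"
proof -
  define G where "G = partition_perm_group X P"
  interpret G: group G unfolding G_def by (rule group_partition_perm_group[OF assms(1)])
  have "X \<noteq> {}" using assms(2) by auto
  then obtain m n \<phi> where m: "0 < m" and n: "0 < n" and \<phi>: "bij_betw \<phi> (grid m n) X"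
    and block: "\<And>x y. x \<in> grid m n \<Longrightarrow> y \<in> grid m n \<Longrightarrow>
      same_block P (\<phi> x) (\<phi> y) \<longleftrightarrow> fst x = fst y"
    using uniform_partition_coordinates[OF assms(1) _ assms(3)] by metis
  define \<psi> where "\<psi> = inv_into (grid m n) \<phi>"
  have \<psi>: "bij_betw \<psi> X (grid m n)" unfolding \<psi>_def by (rule bij_betw_inv_into[OF \<phi>])
  have \<psi>_mem: "\<psi> x \<in> grid m n" if "x \<in> X" for x using bij_betwE[OF \<psi>] that by blast
  have \<phi>_mem: "\<phi> x \<in> X" if "x \<in> grid m n" for x using bij_betwE[OF \<phi>] that by blast
  have \<psi>\<phi>: "\<psi> (\<phi> x) = x" if "x \<in> grid m n" for x
    unfolding \<psi>_def by (rule bij_betw_inv_into_left[OF \<phi> that])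
  have \<phi>\<psi>: "\<phi> (\<psi> x) = x" if "x \<in> X" for x
    unfolding \<psi>_def by (rule bij_betw_inv_into_right[OF \<phi> that])
  define \<Phi> where "\<Phi> p = (\<lambda>x\<in>X. \<phi> (p (\<psi> x)))" for p
  have block_\<psi>: "same_block P x y \<longleftrightarrow> fst (\<psi> x) = fst (\<psi> y)" if "x \<in> X" "y \<in> X" for x y
    using block[OF \<psi>_mem \<psi>_mem, OF that] \<phi>\<psi> that by simp
  have mult: "e \<otimes>\<^bsub>G\<^esub> d = compose X d e" for d e by (simp add: G_def partition_perm_group_def)
  have one: "\<one>\<^bsub>G\<^esub> = (\<lambda>x\<in>X. x)" by (simp add: G_def partition_perm_group_def)
  have \<Phi>_carrier: "\<Phi> p \<in> carrier G" if p: "p \<in> row_perms m n" for p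
  proof -
    have pp: "p permutes grid m n" using p by (simp add: row_perms_def)
    have "bij_betw (\<phi> \<circ> p \<circ> \<psi>) X X"
      using bij_betw_trans[OF bij_betw_trans[OF \<psi> permutes_imp_bij[OF pp]] \<phi>]
      by (simp add: comp_assoc)
    then have "bij_betw (\<Phi> p) X X"
      using bij_betw_cong[of X "\<phi> \<circ> p \<circ> \<psi>" "\<Phi> p" X] by (simp add: \<Phi>_def)
    moreover have "same_block P (\<Phi> p x) (\<Phi> p y)"
      if xy: "x \<in> X" "y \<in> X" "same_block P x y" for x y
    proof -
      obtain i j i' j' where ij: "\<psi> x = (i, j)" "\<psi> y = (i', j')" by fastforce
      have "i < m" "j < n" "j' < n" "i' = i"
        using \<psi>_mem[OF xy(1)] \<psi>_mem[OF xy(2)] block_\<psi>[OF xy(1,2)] xy(3) ij by auto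
      moreover from this have "fst (p (i, j)) = fst (p (i, j'))"
        using p unfolding row_perms_def by blast
      ultimately have "fst (p (\<psi> x)) = fst (p (\<psi> y))" using ij by metis
      then have "same_block P (\<phi> (p (\<psi> x))) (\<phi> (p (\<psi> y)))"
        using block permutes_in_image[OF pp] \<psi>_mem xy by simp
      then show ?thesis using xy by (simp add: \<Phi>_def)
    qed
    ultimately show ?thesis unfolding G_def carrier_partition_perm_group by (simp add: \<Phi>_def)
  qed
  have \<Phi>_onto: "\<exists>p\<in>row_perms m n. e = \<Phi> p" if e: "e \<in> carrier G" for e
  proof
    let ?p = "\<lambda>x. if x \<in> grid m n then \<psi> (e (\<phi> x)) else x"
    have ext: "e \<in> extensional X" and bij: "bij_betw e X X"
      and pres: "\<And>x y. x \<in> X \<Longrightarrow> y \<in> X \<Longrightarrow> same_block P x y \<Longrightarrow> same_block P (e x) (e y)"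
      using e unfolding G_def carrier_partition_perm_group by blast+
    have "bij_betw (\<psi> \<circ> e \<circ> \<phi>) (grid m n) (grid m n)"
      using bij_betw_trans[OF bij_betw_trans[OF \<phi> bij] \<psi>] by (simp add: comp_assoc)
    then have "bij_betw ?p (grid m n) (grid m n)"
      using bij_betw_cong[of "grid m n" "\<psi> \<circ> e \<circ> \<phi>" ?p "grid m n"] by simp
    then have "?p permutes grid m n" by (rule bij_imp_permutes) simp
    moreover have "fst (?p (i, j)) = fst (?p (i, j'))" if "i < m" "j < n" "j' < n" for i j j'
    proof -
      have mem: "(i, j) \<in> grid m n" "(i, j') \<in> grid m n" using that by auto
      then have "same_block P (\<phi> (i, j)) (\<phi> (i, j'))" using block by simp
      then have "same_block P (e (\<phi> (i, j))) (e (\<phi> (i, j')))" using pres \<phi>_mem mem by blast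
      then have "fst (\<psi> (e (\<phi> (i, j)))) = fst (\<psi> (e (\<phi> (i, j'))))"
        using block_\<psi> bij_betwE[OF bij] \<phi>_mem mem by blast
      then show ?thesis using mem by simp
    qed
    ultimately show "?p \<in> row_perms m n" unfolding row_perms_def by blast
    show "e = \<Phi> ?p"
    proof
      fix x show "e x = \<Phi> ?p x"
        using ext bij_betwE[OF bij] \<psi>_mem \<phi>\<psi> by (cases "x \<in> X") (auto simp: \<Phi>_def extensional_def)
    qed
  qed
  obtain f g where f: "f \<in> row_perms m n" and g: "g \<in> row_perms m n"
    and gen: "\<And>H. perm_group (grid m n) H \<Longrightarrow> f \<in> H \<Longrightarrow> g \<in> H \<Longrightarrow> row_perms m n \<subseteq> H"
    using row_perms_two_generators[OF m n] by blast
  have sub: "{\<Phi> f, \<Phi> g} \<subseteq> carrier G" using \<Phi>_carrier f g by blast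
  interpret E: subgroup "generate G {\<Phi> f, \<Phi> g}" G by (rule G.generate_is_subgroup[OF sub])
  define H where "H = {p. p permutes grid m n \<and> \<Phi> p \<in> generate G {\<Phi> f, \<Phi> g}}"
  have "perm_group (grid m n) H"
    unfolding H_def
  proof (unfold_locales; (elim CollectE conjE)?)
    show "id \<in> {p. p permutes grid m n \<and> \<Phi> p \<in> generate G {\<Phi> f, \<Phi> g}}"
    proof -
      have "\<Phi> id = \<one>\<^bsub>G\<^esub>" using \<phi>\<psi> by (auto simp: \<Phi>_def one)
      then show ?thesis using E.one_closed permutes_id by auto
    qed
  next
    fix p q
    assume p: "p permutes grid m n" "\<Phi> p \<in> generate G {\<Phi> f, \<Phi> g}"
      and q: "q permutes grid m n" "\<Phi> q \<in> generate G {\<Phi> f, \<Phi> g}"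
    have q_mem: "q (\<psi> x) \<in> grid m n" if "x \<in> X" for x
      using permutes_in_image[OF q(1), of "\<psi> x"] \<psi>_mem[OF that] by blast
    have "\<Phi> (p \<circ> q) = \<Phi> q \<otimes>\<^bsub>G\<^esub> \<Phi> p"
    proof
      fix x show "\<Phi> (p \<circ> q) x = (\<Phi> q \<otimes>\<^bsub>G\<^esub> \<Phi> p) x"
        by (simp add: \<Phi>_def mult compose_def \<phi>_mem \<psi>\<phi> q_mem del: mem_Sigma_iff)
    qed
    then show "p \<circ> q \<in> {p. p permutes grid m n \<and> \<Phi> p \<in> generate G {\<Phi> f, \<Phi> g}}"
      using E.m_closed[OF q(2) p(2)] permutes_compose[OF q(1) p(1)] by simp
  next
    fix p assume p: "p permutes grid m n" "\<Phi> p \<in> generate G {\<Phi> f, \<Phi> g}"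
    have pi: "inv_into UNIV p permutes grid m n" by (rule permutes_inv[OF p(1)])
    define e where "e = inv\<^bsub>G\<^esub> (\<Phi> p)"
    have eE: "e \<in> generate G {\<Phi> f, \<Phi> g}" unfolding e_def by (rule E.m_inv_closed[OF p(2)])
    have "\<Phi> p \<in> carrier G" using p(2) E.subset by blast
    then have "e \<otimes>\<^bsub>G\<^esub> \<Phi> p = \<one>\<^bsub>G\<^esub>" unfolding e_def by (rule G.l_inv)
    then have "compose X (\<Phi> p) e x = x" if "x \<in> X" for x using that by (simp add: mult one)
    then have \<Phi>e: "\<Phi> p (e x) = x" if "x \<in> X" for x using that by (simp add: compose_eq)
    have eG: "e \<in> carrier G" using eE E.subset by blast
    have ext: "e \<in> extensional X" and bij: "bij_betw e X X"
      using eG unfolding G_def carrier_partition_perm_group by blast+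
    \<comment> \<open>The inverse is identified pointwise because \<open>p\<close> is not known to preserve the rows here,
      which bars the use of \<open>\<Phi>_carrier\<close>.\<close>
    have "e = \<Phi> (inv_into UNIV p)"
    proof
      fix x show "e x = \<Phi> (inv_into UNIV p) x"
      proof (cases "x \<in> X")
        case True
        then have ex: "e x \<in> X" using bij_betwE[OF bij] by blast
        then have "\<phi> (p (\<psi> (e x))) = x" using \<Phi>e[OF True] by (simp add: \<Phi>_def)
        then have "\<psi> x = p (\<psi> (e x))"
          using \<psi>\<phi> permutes_in_image[OF p(1)] \<psi>_mem[OF ex] by metis
        then have "inv_into UNIV p (\<psi> x) = \<psi> (e x)" using permutes_inverses(2)[OF p(1)] by simp
        then show ?thesis using True \<phi>\<psi>[OF ex] by (simp add: \<Phi>_def)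
      qed (use ext in \<open>simp add: \<Phi>_def extensional_def\<close>)
    qed
    then show "inv_into UNIV p \<in> {p. p permutes grid m n \<and> \<Phi> p \<in> generate G {\<Phi> f, \<Phi> g}}"
      using eE pi by simp
  qed auto
  moreover have "f \<in> H" "g \<in> H"
    using f g by (auto simp: H_def row_perms_def intro: generate.incl)
  ultimately have "row_perms m n \<subseteq> H" by (rule gen)
  then have "carrier G \<subseteq> generate G {\<Phi> f, \<Phi> g}" using \<Phi>_onto by (auto simp: H_def)
  then have "generate G {\<Phi> f, \<Phi> g} = carrier G" using E.subset by blast
  then show ?thesis using sub unfolding G_def by blast
qed

end
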